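(* Let $p>3$ be a prime. Then $$\sum_{k=1}^{p-1}\frac{H_kL_k}{k}\equiv 0\pmod p\quad\text{and}\quad \sum_{k=1}^{p-1}\frac{F_kH_k}{k}\equiv\frac 2p\sum_{k=1}^{p-1}\frac{F_k}{k}\pmod p.$$
   Context: For $n\in\{0,1,2,\ldots\}$, the harmonic number is $H_n=\sum_{0<j\le n}1/j$. $F_n$ and $L_n$ are the Fibonacci and Lucas numbers: $F_0=0$, $F_1=1$, $F_{n+1}=F_n+F_{n-1}$ for $n\ge 1$; $L_0=2$, $L_1=1$, $L_{n+1}=L_n+L_{n-1}$ for $n\ge 1$. A congruence $x\equiv y\pmod{p}$ between rational numbers means that $x-y\in p\,\mathbb{Z}_{(p)}$, where $\mathbb{Z}_{(p)}$ is the ring of rational numbers whose denominator (in lowest terms) is prime to $p$. *)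

theory Defs
  imports "HOL-Number_Theory.Fib" "HOL-Computational_Algebra.Primes"
    "HOL-Analysis.Harmonic_Numbers"
begin

fun lucas :: "nat \<Rightarrow> nat" where
  "lucas 0 = 2"
| "lucas (Suc 0) = 1"
| "lucas (Suc (Suc n)) = lucas (Suc n) + lucas n"

(* The library constant harm lives in real normed fields, hence not in rat. *)
definition harmonic :: "nat \<Rightarrow> rat" where
  "harmonic n = (\<Sum>j\<in>{0<..n}. 1 / of_nat j)"

lemma of_rat_harmonic: "(of_rat (harmonic n) :: real) = harm n"
proof -
  have "{0<..n} = {1..n}" by auto
  then show ?thesis
    by (simp add: harmonic_def harm_def of_rat_sum of_rat_divide inverse_eq_divide)
qed

(* The ring \<int>_(p); quotient_of yields the fraction in lowest terms with positive denominator. *)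
definition p_integral :: "nat \<Rightarrow> rat set" where
  "p_integral p = {x. coprime (snd (quotient_of x)) (int p)}"

definition rat_cong :: "rat \<Rightarrow> rat \<Rightarrow> nat \<Rightarrow> bool" where
  "rat_cong x y p \<longleftrightarrow> (\<exists>z \<in> p_integral p. x - y = of_nat p * z)"

end

theory Submission
  imports Defs
begin

text \<open>
  For \<open>0 \<le> k < p\<close> the factors \<open>1 - p/j\<close> of \<open>(-1)\<^sup>k (p-1 choose k)\<close> give
  \<open>(-1)\<^sup>k (p-1 choose k) \<equiv> 1 - p H\<^sub>k\<close> modulo \<open>p\<^sup>2\<close>.  Harmonic sums modulo \<open>p\<close> are therefore
  hidden in the second-order term of alternating binomial sums, which can be evaluated exactly:
  if \<open>g\<close> is the binomial transform of \<open>f\<close>, that is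
  \<open>g m = (\<Sum>k\<le>m. (-1)\<^sup>k (m choose k) f k)\<close>, then
  \<open>(\<Sum>k=1..n. (-1)\<^sup>k (n choose k) f k / k) = (\<Sum>k=1..n. (g k - f 0) / k)\<close>.
  With \<open>n = p - 1\<close> the two facts combine to
  \<open>p (\<Sum>k=1..p-1. H\<^sub>k f k / k) \<equiv> (\<Sum>k=1..p-1. (f 0 + f k - g k) / k)\<close> modulo \<open>p\<^sup>2\<close>
  (lemma \<open>harmonic_sum_cong\<close>).

  The roots of \<open>x\<^sup>2 = x + 1\<close> are exchanged by \<open>x \<mapsto> 1 - x\<close>, so the binomial transform maps
  \<open>F\<close> to \<open>-F\<close> and \<open>L\<close> to \<open>L\<close>.  For \<open>f = F\<close> the right-hand side is twice the sum of
  \<open>F\<^sub>k / k\<close>, and division by \<open>p\<close> yields the second congruence.  For \<open>f = L\<close> it is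
  \<open>2 H\<^sub>p\<^sub>-\<^sub>1\<close>, which vanishes modulo \<open>p\<^sup>2\<close> by Wolstenholme's theorem.
  The latter comes from the same source: the constant sequence \<open>f = 1\<close> relates
  \<open>H\<^sub>p\<^sub>-\<^sub>1\<close> to the sum of \<open>1/k\<^sup>2\<close>, the pairing of \<open>k\<close> with \<open>p - k\<close> gives another such
  relation, and for \<open>p > 3\<close> the two are independent.
\<close>

section \<open>Rationals with denominator prime to p\<close>

lemma p_integral_iff:
  assumes "prime p"
  shows "x \<in> p_integral p \<longleftrightarrow> (\<exists>a b. \<not> int p dvd b \<and> x = of_int a / of_int b)"
proof
  assume x: "x \<in> p_integral p"
  obtain a b where ab: "quotient_of x = (a, b)" by fastforce
  have "coprime b (int p)" using x ab by (simp add: p_integral_def)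
  then have "\<not> int p dvd b"
    using assms by (metis coprime_absorb_right not_prime_unit prime_nat_int_transfer)
  with quotient_of_div[OF ab] show "\<exists>a b. \<not> int p dvd b \<and> x = of_int a / of_int b" by blast
next
  assume "\<exists>a b. \<not> int p dvd b \<and> x = of_int a / of_int b"
  then obtain a b where nd: "\<not> int p dvd b" and x: "x = of_int a / of_int b" by blast
  obtain c d where cd: "quotient_of x = (c, d)" by fastforce
  have d0: "d > 0" and cop: "coprime c d"
    using quotient_of_denom_pos[OF cd] quotient_of_coprime[OF cd] by auto
  have b0: "b \<noteq> 0" using nd by auto
  have "(of_int (c * b) :: rat) = of_int (a * d)"
    using x quotient_of_div[OF cd] d0 b0 by (simp add: field_simps)
  then have "c * b = a * d" by (simp only: of_int_eq_iff)
  then have "d dvd c * b" by simp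
  then have "d dvd b" using cop by (simp add: coprime_commute coprime_dvd_mult_right_iff)
  then have "\<not> int p dvd d" using nd dvd_trans by blast
  then have "coprime (int p) d"
    using assms by (simp add: prime_imp_coprime)
  then show "x \<in> p_integral p" by (simp add: p_integral_def cd coprime_commute)
qed

lemma p_integral_of_int: "of_int a \<in> p_integral p"
  by (simp add: p_integral_def)

lemma p_integral_of_nat: "of_nat a \<in> p_integral p"
  using p_integral_of_int[of "int a"] by simp

lemma p_integral_add:
  assumes "prime p" "x \<in> p_integral p" "y \<in> p_integral p"
  shows "x + y \<in> p_integral p"
proof -
  obtain a b c d where "\<not> int p dvd b" "x = of_int a / of_int b"
    "\<not> int p dvd d" "y = of_int c / of_int d"
    using assms by (auto simp: p_integral_iff)
  moreover from this have "b \<noteq> 0" "d \<noteq> 0" by auto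
  ultimately have "\<not> int p dvd b * d \<and> x + y = of_int (a * d + c * b) / of_int (b * d)"
    using assms(1) by (simp add: prime_dvd_mult_iff field_simps)
  then show ?thesis using assms(1) p_integral_iff by blast
qed

lemma p_integral_mult:
  assumes "prime p" "x \<in> p_integral p" "y \<in> p_integral p"
  shows "x * y \<in> p_integral p"
proof -
  obtain a b c d where "\<not> int p dvd b" "x = of_int a / of_int b"
    "\<not> int p dvd d" "y = of_int c / of_int d"
    using assms by (auto simp: p_integral_iff)
  then have "\<not> int p dvd b * d \<and> x * y = of_int (a * c) / of_int (b * d)"
    using assms(1) by (simp add: prime_dvd_mult_iff)
  then show ?thesis using assms(1) p_integral_iff by blast
qed

lemma p_integral_uminus:
  assumes "prime p" "x \<in> p_integral p"
  shows "- x \<in> p_integral p"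
  using p_integral_mult[OF assms(1) p_integral_of_int[of "-1"] assms(2)] by simp

lemma p_integral_diff:
  assumes "prime p" "x \<in> p_integral p" "y \<in> p_integral p"
  shows "x - y \<in> p_integral p"
  using p_integral_add[OF assms(1,2) p_integral_uminus[OF assms(1,3)]] by simp

lemma p_integral_sum:
  assumes "prime p" "\<And>i. i \<in> A \<Longrightarrow> f i \<in> p_integral p"
  shows "sum f A \<in> p_integral p"
  using assms(2)
  by (induction A rule: infinite_finite_induct)
    (auto intro: p_integral_add[OF assms(1)] simp: p_integral_of_int[of 0, simplified])

lemma p_integral_inverse:
  assumes "prime p" "\<not> p dvd k"
  shows "1 / of_nat k \<in> p_integral p"
proof -
  have "\<not> int p dvd int k \<and> (1 / of_nat k :: rat) = of_int 1 / of_int (int k)"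
    using assms(2) by simp
  then show ?thesis using assms(1) p_integral_iff by blast
qed

lemma p_integral_inverse_less:
  assumes "prime p" "0 < k" "k < p"
  shows "1 / of_nat k \<in> p_integral p"
  using assms by (intro p_integral_inverse) (auto dest: dvd_imp_le)

lemma p_integral_harmonic:
  assumes "prime p" "k < p"
  shows "harmonic k \<in> p_integral p"
  unfolding harmonic_def
  using assms by (intro p_integral_sum p_integral_inverse_less) auto

text \<open>
  The ideal generated by \<open>p\<^sup>e\<close>.  The proof needs congruences modulo \<open>p\<^sup>2\<close>, since the harmonic
  sums appear with a factor \<open>p\<close>.
\<close>

definition p_ideal :: "nat \<Rightarrow> nat \<Rightarrow> rat set" where
  "p_ideal p e = (\<lambda>z. of_nat p ^ e * z) ` p_integral p"

lemma p_idealI: "z \<in> p_integral p \<Longrightarrow> x = of_nat p ^ e * z \<Longrightarrow> x \<in> p_ideal p e"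
  by (auto simp: p_ideal_def)

lemma rat_cong_iff_p_ideal: "rat_cong x y p \<longleftrightarrow> x - y \<in> p_ideal p 1"
  by (auto simp: rat_cong_def p_ideal_def)

lemma p_ideal_add:
  assumes "prime p" "x \<in> p_ideal p e" "y \<in> p_ideal p e"
  shows "x + y \<in> p_ideal p e"
  using assms unfolding p_ideal_def
  by (auto simp: distrib_left[symmetric] intro!: imageI p_integral_add)

lemma p_ideal_mult_left:
  assumes "prime p" "c \<in> p_integral p" "x \<in> p_ideal p e"
  shows "c * x \<in> p_ideal p e"
proof -
  obtain z where "z \<in> p_integral p" "x = of_nat p ^ e * z"
    using assms(3) by (auto simp: p_ideal_def)
  then show ?thesis
    by (intro p_idealI[of "c * z"] p_integral_mult assms) simp_all
qed

lemma p_ideal_uminus: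
  assumes "prime p" "x \<in> p_ideal p e"
  shows "- x \<in> p_ideal p e"
  using p_ideal_mult_left[OF assms(1) p_integral_of_int[of "-1"] assms(2)] by simp

lemma p_ideal_diff:
  assumes "prime p" "x \<in> p_ideal p e" "y \<in> p_ideal p e"
  shows "x - y \<in> p_ideal p e"
  using p_ideal_add[OF assms(1,2) p_ideal_uminus[OF assms(1,3)]] by simp

lemma p_ideal_sum:
  assumes "prime p" "\<And>i. i \<in> A \<Longrightarrow> f i \<in> p_ideal p e"
  shows "sum f A \<in> p_ideal p e"
proof -
  have "0 \<in> p_ideal p e"
    by (rule p_idealI[of 0]) (simp_all add: p_integral_of_int[of 0, simplified])
  with assms(2) show ?thesis
    by (induction A rule: infinite_finite_induct) (auto intro: p_ideal_add[OF assms(1)])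
qed

lemma p_ideal_mult:
  assumes "prime p" "x \<in> p_ideal p d" "y \<in> p_ideal p e"
  shows "x * y \<in> p_ideal p (d + e)"
proof -
  obtain z w where "z \<in> p_integral p" "x = of_nat p ^ d * z"
    "w \<in> p_integral p" "y = of_nat p ^ e * w"
    using assms(2,3) by (auto simp: p_ideal_def)
  then show ?thesis
    by (intro p_idealI[of "z * w"] p_integral_mult assms) (simp_all add: power_add)
qed

lemma p_ideal_cancel_p:
  assumes "prime p" "of_nat p * x \<in> p_ideal p (Suc e)"
  shows "x \<in> p_ideal p e"
proof -
  obtain z where "z \<in> p_integral p" "of_nat p * x = of_nat p * (of_nat p ^ e * z)"
    using assms(2) by (auto simp: p_ideal_def mult.assoc)
  moreover have "(of_nat p :: rat) \<noteq> 0" using assms(1) by auto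
  ultimately show ?thesis by (intro p_idealI[of z]) (simp_all only: mult_left_cancel simp_thms)
qed

lemma p_ideal_cancel_unit:
  assumes "prime p" "\<not> p dvd k" "of_nat k * x \<in> p_ideal p e"
  shows "x \<in> p_ideal p e"
proof -
  have "k \<noteq> 0" using assms(2) by (metis dvd_0_right)
  then show ?thesis
    using p_ideal_mult_left[OF assms(1) p_integral_inverse[OF assms(1,2)] assms(3)] by simp
qed

section \<open>Binomial transforms\<close>

definition binomial_transform :: "(nat \<Rightarrow> rat) \<Rightarrow> nat \<Rightarrow> rat" where
  "binomial_transform f n = (\<Sum>k\<le>n. (-1) ^ k * of_nat (n choose k) * f k)"

text \<open>
  Pascal's rule: in terms of the shift \<open>E f = f \<circ> Suc\<close>, the transform is \<open>((1 - E)\<^sup>n f) 0\<close>.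
\<close>

lemma binomial_transform_Suc:
  "binomial_transform f (Suc n) = binomial_transform (\<lambda>k. f k - f (Suc k)) n"
proof -
  have "binomial_transform f (Suc n) =
      f 0 + (\<Sum>k\<le>n. (-1) ^ Suc k * of_nat (Suc n choose Suc k) * f (Suc k))"
    unfolding binomial_transform_def by (subst sum.atMost_Suc_shift) simp
  also have "\<dots> = f 0 + (\<Sum>k\<le>n. (-1) ^ Suc k * of_nat (n choose Suc k) * f (Suc k))
      - (\<Sum>k\<le>n. (-1) ^ k * of_nat (n choose k) * f (Suc k))"
    by (simp add: algebra_simps sum.distrib sum_negf sum_subtractf)
  also have "f 0 + (\<Sum>k\<le>n. (-1) ^ Suc k * of_nat (n choose Suc k) * f (Suc k)) =
      (\<Sum>k\<le>Suc n. (-1) ^ k * of_nat (n choose k) * f k)"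
    by (subst sum.atMost_Suc_shift) simp
  also have "\<dots> = (\<Sum>k\<le>n. (-1) ^ k * of_nat (n choose k) * f k)"
    by simp
  finally show ?thesis
    by (simp add: binomial_transform_def right_diff_distrib sum_subtractf)
qed

lemma binomial_transform_0: "binomial_transform f 0 = f 0"
  by (simp add: binomial_transform_def)

lemma binomial_transform_add:
  "binomial_transform (\<lambda>k. f k + g k) n = binomial_transform f n + binomial_transform g n"
  by (simp add: binomial_transform_def distrib_left sum.distrib)

text \<open>
  If the shift satisfies \<open>E\<^sup>2 = E + 1\<close> on \<open>f\<close>, then \<open>(1 - E)\<^sup>2 = (1 - E) + 1\<close> on \<open>f\<close>.
\<close>

lemma binomial_transform_fibonacci_recurrence:
  assumes "\<And>k. f (Suc (Suc k)) = f (Suc k) + f k"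
  shows "binomial_transform f (Suc (Suc n)) =
    binomial_transform f (Suc n) + binomial_transform f n"
  using assms by (simp add: binomial_transform_Suc binomial_transform_add[symmetric])

lemma binomial_transform_fib:
  "binomial_transform (\<lambda>k. of_nat (fib k)) n = - of_nat (fib n)"
  by (induction n rule: fib.induct)
    (simp_all add: binomial_transform_fibonacci_recurrence binomial_transform_Suc[of _ 0]
      binomial_transform_0)

lemma binomial_transform_lucas:
  "binomial_transform (\<lambda>k. of_nat (lucas k)) n = of_nat (lucas n)"
  by (induction n rule: lucas.induct)
    (simp_all add: binomial_transform_fibonacci_recurrence binomial_transform_Suc[of _ 0]
      binomial_transform_0)

lemma binomial_transform_one:
  assumes "n > 0"
  shows "binomial_transform (\<lambda>k. 1) n = 0"
  using assms by (cases n) (simp_all add: binomial_transform_Suc, simp add: binomial_transform_def)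

text \<open>
  Since \<open>(n+1 choose k) / k - (n choose k) / k = (n+1 choose k) / (n+1)\<close>, the increment of the
  left-hand side from \<open>n\<close> to \<open>n + 1\<close> is a transform value divided by \<open>n + 1\<close>.
  The subtraction of \<open>f 0\<close> accounts for the index \<open>k = 0\<close>, which the left-hand side omits.
\<close>

lemma sum_binomial_over_index:
  "(\<Sum>k=1..n. (-1) ^ k * of_nat (n choose k) * f k / of_nat k) =
   (\<Sum>k=1..n. (binomial_transform f k - f 0) / of_nat k)"
proof (induction n)
  case (Suc n)
  have step: "(-1) ^ k * of_nat (Suc n choose k) * f k / of_nat k =
      (-1) ^ k * of_nat (n choose k) * f k / of_nat k +
      (-1) ^ k * of_nat (Suc n choose k) * f k / of_nat (Suc n)" if "k \<in> {1..Suc n}" for k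
  proof -
    from that obtain j where j: "k = Suc j" by (cases k) auto
    have "(of_nat (Suc j) * of_nat (Suc n choose Suc j) :: rat) =
        of_nat (Suc n) * of_nat (n choose j)"
      using Suc_times_binomial_eq[of n j] by (simp only: of_nat_mult[symmetric] mult.commute)
    then have "(of_nat (Suc n choose k) :: rat) / of_nat k =
        of_nat (n choose k) / of_nat k + of_nat (Suc n choose k) / of_nat (Suc n)"
      unfolding j by (simp add: divide_simps del: of_nat_Suc) (simp add: algebra_simps)
    then have "((-1) ^ k * f k) * (of_nat (Suc n choose k) / of_nat k) = ((-1) ^ k * f k) *
        (of_nat (n choose k) / of_nat k + of_nat (Suc n choose k) / of_nat (Suc n))"
      by simp
    then show ?thesis by (simp add: algebra_simps del: of_nat_Suc binomial_Suc_Suc)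
  qed
  have "(\<Sum>k=1..Suc n. (-1) ^ k * of_nat (Suc n choose k) * f k / of_nat k) =
      (\<Sum>k=1..Suc n. (-1) ^ k * of_nat (n choose k) * f k / of_nat k) +
      (\<Sum>k=1..Suc n. (-1) ^ k * of_nat (Suc n choose k) * f k) / of_nat (Suc n)"
    by (subst sum.cong[OF refl step], assumption)
      (simp only: sum.distrib sum_divide_distrib)
  also have "(\<Sum>k=1..Suc n. (-1) ^ k * of_nat (Suc n choose k) * f k) =
      binomial_transform f (Suc n) - f 0"
    unfolding binomial_transform_def atMost_atLeast0
    by (subst (2) sum.atLeast_Suc_atMost) simp_all
  also have "(\<Sum>k=1..Suc n. (-1) ^ k * of_nat (n choose k) * f k / of_nat k) =
      (\<Sum>k=1..n. (-1) ^ k * of_nat (n choose k) * f k / of_nat k)"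
    by simp
  finally show ?case using Suc.IH by simp
qed simp

section \<open>Harmonic numbers modulo the square of p\<close>

lemma harmonic_Suc: "harmonic (Suc n) = harmonic n + 1 / of_nat (Suc n)"
proof -
  have "{0<..Suc n} = insert (Suc n) {0<..n}" by auto
  then show ?thesis by (simp add: harmonic_def)
qed

lemma harmonic_altdef: "harmonic n = (\<Sum>k=1..n. 1 / of_nat k)"
proof -
  have "{0<..n} = {1..n}" by auto
  then show ?thesis by (simp add: harmonic_def)
qed

text \<open>The first-order expansion of the product of the factors \<open>1 - p/j\<close> for \<open>1 \<le> j \<le> k\<close>.\<close>

lemma binomial_prime_minus_one_cong:
  assumes "prime p" "k < p"
  shows "(-1) ^ k * of_nat (p - 1 choose k) - (1 - of_nat p * harmonic k) \<in> p_ideal p 2"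
  using assms(2)
proof (induction k)
  case 0
  show ?case
    by (rule p_idealI[of 0])
      (simp_all add: harmonic_def p_integral_of_int[of 0, simplified])
next
  case (Suc k)
  define c :: rat where "c = (-1) ^ k * of_nat (p - 1 choose k)"
  define u :: rat where "u = 1 / of_nat (Suc k)"
  define h where "h = harmonic k"
  have u: "u \<in> p_integral p"
    unfolding u_def using Suc.prems assms(1) by (intro p_integral_inverse_less) auto
  have h: "h \<in> p_integral p"
    unfolding h_def using Suc.prems assms(1) by (intro p_integral_harmonic) auto
  have factor: "(-1) ^ Suc k * of_nat (p - 1 choose Suc k) = c * (1 - of_nat p * u)"
  proof -
    have "Suc k * (p - 1 choose Suc k) = (p - 1 - k) * (p - 1 choose k)"
      by (metis binomial_absorb_comp binomial_absorption)
    then have "(of_nat (Suc k) * of_nat (p - 1 choose Suc k) :: rat) =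
        of_nat (p - 1 - k) * of_nat (p - 1 choose k)"
      by (metis of_nat_mult)
    moreover have "(of_nat (p - 1 - k) :: rat) = of_nat p - of_nat (Suc k)"
      using Suc.prems by (simp add: of_nat_diff)
    ultimately have next_coeff: "(of_nat (p - 1 choose Suc k) :: rat) =
        - (1 - of_nat p * u) * of_nat (p - 1 choose k)"
      unfolding u_def by (simp add: divide_simps del: of_nat_Suc) (simp add: algebra_simps)
    show ?thesis unfolding c_def next_coeff by (simp add: algebra_simps)
  qed
  have "(1 - of_nat p * u) * (c - (1 - of_nat p * h)) \<in> p_ideal p 2"
    using Suc assms(1) p_integral_of_int[of 1 p] unfolding c_def h_def
    by (intro p_ideal_mult_left p_integral_diff p_integral_mult u p_integral_of_nat) auto
  moreover have "of_nat p ^ 2 * (h * u) \<in> p_ideal p 2"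
    using assms(1) u h by (intro p_idealI[OF _ refl] p_integral_mult)
  ultimately have "(1 - of_nat p * u) * (c - (1 - of_nat p * h)) + of_nat p ^ 2 * (h * u)
      \<in> p_ideal p 2"
    by (rule p_ideal_add[OF assms(1)])
  also have "(1 - of_nat p * u) * (c - (1 - of_nat p * h)) + of_nat p ^ 2 * (h * u) =
      c * (1 - of_nat p * u) - (1 - of_nat p * (h + u))"
    by (simp add: algebra_simps power2_eq_square)
  finally show ?case
    unfolding factor harmonic_Suc h_def u_def .
qed

text \<open>
  The exact evaluation of \<open>sum_binomial_over_index\<close> at \<open>n = p - 1\<close>, with the binomial
  coefficients replaced by their expansions modulo \<open>p\<^sup>2\<close>.
\<close>

lemma harmonic_sum_cong:
  assumes "prime p" "\<And>k. f k \<in> p_integral p"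
  shows "of_nat p * (\<Sum>k=1..p-1. harmonic k * f k / of_nat k)
    - (\<Sum>k=1..p-1. (f 0 + f k - binomial_transform f k) / of_nat k) \<in> p_ideal p 2"
proof -
  let ?b = "\<lambda>k. (-1) ^ k * of_nat (p - 1 choose k) :: rat"
  have "(\<Sum>k=1..p-1. (f k * (1 / of_nat k)) * (?b k - (1 - of_nat p * harmonic k)))
      \<in> p_ideal p 2"
    using assms
    by (intro p_ideal_sum p_ideal_mult_left p_integral_mult p_integral_inverse_less
        binomial_prime_minus_one_cong) auto
  also have "(\<Sum>k=1..p-1. (f k * (1 / of_nat k)) * (?b k - (1 - of_nat p * harmonic k))) =
      (\<Sum>k=1..p-1. ?b k * f k / of_nat k - f k / of_nat k
        + of_nat p * (harmonic k * f k / of_nat k))"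
    by (rule sum.cong) (simp_all add: algebra_simps)
  also have "\<dots> = (\<Sum>k=1..p-1. ?b k * f k / of_nat k) - (\<Sum>k=1..p-1. f k / of_nat k)
      + of_nat p * (\<Sum>k=1..p-1. harmonic k * f k / of_nat k)"
    by (simp add: sum.distrib sum_subtractf sum_distrib_left)
  also have "(\<Sum>k=1..p-1. ?b k * f k / of_nat k) =
      (\<Sum>k=1..p-1. (binomial_transform f k - f 0) / of_nat k)"
    by (rule sum_binomial_over_index)
  finally show ?thesis
    by (simp add: diff_divide_distrib add_divide_distrib sum.distrib sum_subtractf algebra_simps)
qed

lemma sum_harmonic_over_index:
  "2 * (\<Sum>k=1..n. harmonic k / of_nat k) = harmonic n ^ 2 + (\<Sum>k=1..n. 1 / of_nat k ^ 2)"
proof (induction n)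
  case (Suc n)
  define u :: rat where "u = 1 / of_nat (Suc n)"
  have "2 * (\<Sum>k=1..Suc n. harmonic k / of_nat k) =
      2 * (\<Sum>k=1..n. harmonic k / of_nat k) + 2 * (harmonic n + u) * u"
    by (simp add: harmonic_Suc u_def[symmetric] divide_inverse distrib_left)
       (simp add: u_def divide_inverse)
  also have "\<dots> = (harmonic n + u) ^ 2 + ((\<Sum>k=1..n. 1 / of_nat k ^ 2) + u ^ 2)"
    using Suc.IH by (simp add: algebra_simps power2_eq_square)
  finally show ?case
    by (simp add: harmonic_Suc u_def power_divide)
qed (simp add: harmonic_def)

text \<open>
  Pairing: \<open>1/k + 1/(p-k) = p/(k(p-k))\<close>, and \<open>k(p-k) \<equiv> -k\<^sup>2\<close> modulo \<open>p\<close>.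
\<close>

lemma harmonic_prime_pairing:
  assumes "prime p"
  shows "2 * harmonic (p - 1) + of_nat p * (\<Sum>k=1..p-1. 1 / of_nat k ^ 2) \<in> p_ideal p 2"
proof -
  have p1: "p > 1" using assms by (rule prime_gt_1_nat)
  have "harmonic (p - 1) = (\<Sum>k=1..p-1. 1 / of_nat (p - k))"
    unfolding harmonic_altdef using p1 by (subst sum.atLeastAtMost_rev) simp
  then have "2 * harmonic (p - 1) + of_nat p * (\<Sum>k=1..p-1. 1 / of_nat k ^ 2) =
      (\<Sum>k=1..p-1. 1 / of_nat k) + (\<Sum>k=1..p-1. 1 / of_nat (p - k))
        + of_nat p * (\<Sum>k=1..p-1. 1 / of_nat k ^ 2)"
    by (simp add: harmonic_altdef)
  also have "\<dots> =
      (\<Sum>k=1..p-1. 1 / of_nat k + 1 / of_nat (p - k) + of_nat p * (1 / of_nat k ^ 2))"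
    by (simp add: sum.distrib sum_distrib_left)
  also have "\<dots> = (\<Sum>k=1..p-1. of_nat p ^ 2 *
      ((1 / of_nat k) * (1 / of_nat k) * (1 / of_nat (p - k))))"
  proof (rule sum.cong)
    fix k assume "k \<in> {1..p-1}"
    then have k: "0 < k" "k < p" by auto
    define a b :: rat where "a = of_nat k" and "b = of_nat (p - k)"
    have "a \<noteq> 0" "b \<noteq> 0" "(of_nat p :: rat) = a + b"
      using k by (simp_all add: a_def b_def of_nat_diff)
    then show "1 / of_nat k + 1 / of_nat (p - k) + of_nat p * (1 / of_nat k ^ 2) =
        of_nat p ^ 2 * ((1 / of_nat k) * (1 / of_nat k) * (1 / of_nat (p - k)) :: rat)"
      unfolding a_def[symmetric] b_def[symmetric]
      by (simp add: divide_simps power2_eq_square) (simp add: algebra_simps)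
  qed simp
  also have "\<dots> \<in> p_ideal p 2"
    using assms
    by (intro p_ideal_sum p_idealI[OF _ refl] p_integral_mult p_integral_inverse_less) auto
  finally show ?thesis .
qed

text \<open>
  Let \<open>H = H\<^sub>p\<^sub>-\<^sub>1\<close> and let \<open>Q\<close> be the sum of \<open>1/k\<^sup>2\<close>.  Modulo \<open>p\<^sup>2\<close>, pairing gives
  \<open>2 H + p Q \<equiv> 0\<close>, so \<open>p\<close> divides \<open>H\<close>; the constant sequence in \<open>harmonic_sum_cong\<close> gives
  \<open>p (H\<^sup>2 + Q) \<equiv> 4 H\<close>.  Elimination of \<open>Q\<close> leaves \<open>6 H \<equiv> 0\<close>.
\<close>

theorem wolstenholme_harmonic:
  assumes "prime p" "p > 3"
  shows "harmonic (p - 1) \<in> p_ideal p 2"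
proof -
  define H where "H = harmonic (p - 1)"
  define Q :: rat where "Q = (\<Sum>k=1..p-1. 1 / of_nat k ^ 2)"
  note p = assms(1)
  have nd2: "\<not> p dvd 2" and nd3: "\<not> p dvd 3"
    using assms(2) by (auto dest: dvd_imp_le)
  then have nd6: "\<not> p dvd 6"
    using prime_dvd_mult_iff[OF p, of 2 3] by simp
  have pairing: "2 * H + of_nat p * Q \<in> p_ideal p 2"
    unfolding H_def Q_def by (rule harmonic_prime_pairing[OF p])
  have Q: "Q \<in> p_integral p"
  proof -
    have "Q = (\<Sum>k=1..p-1. (1 / of_nat k) * (1 / of_nat k))"
      by (simp add: Q_def power2_eq_square)
    also have "\<dots> \<in> p_integral p"
      using p by (intro p_integral_sum p_integral_mult p_integral_inverse_less) auto
    finally show ?thesis .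
  qed
  have H: "H \<in> p_ideal p 1"
  proof -
    obtain z where z: "z \<in> p_integral p" "2 * H + of_nat p * Q = of_nat p ^ 2 * z"
      using pairing by (auto simp: p_ideal_def)
    have "of_nat 2 * H = of_nat p ^ 1 * (of_nat p * z - Q)"
      using z(2) by (simp add: algebra_simps power2_eq_square)
    moreover have "of_nat p * z - Q \<in> p_integral p"
      using p z(1) Q by (intro p_integral_diff p_integral_mult p_integral_of_nat)
    ultimately have "of_nat 2 * H \<in> p_ideal p 1" by (intro p_idealI)
    then show ?thesis by (rule p_ideal_cancel_unit[OF p nd2])
  qed
  have HH: "H ^ 2 \<in> p_ideal p 2"
    using p_ideal_mult[OF p H H] by (simp add: power2_eq_square numeral_2_eq_2)
  have "of_nat p * (\<Sum>k=1..p-1. harmonic k / of_nat k) - (\<Sum>k=1..p-1. 2 / of_nat k)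
      \<in> p_ideal p 2"
    using harmonic_sum_cong[OF p, of "\<lambda>k. 1"] p_integral_of_int[of 1 p]
    by (simp add: binomial_transform_one)
  also have "(\<Sum>k=1..p-1. 2 / of_nat k) = 2 * H"
    by (simp add: H_def harmonic_altdef sum_distrib_left)
  finally have "of_nat 2 * (of_nat p * (\<Sum>k=1..p-1. harmonic k / of_nat k) - 2 * H) \<in> p_ideal p 2"
    by (rule p_ideal_mult_left[OF p p_integral_of_nat])
  also have "of_nat 2 * (of_nat p * (\<Sum>k=1..p-1. harmonic k / of_nat k) - 2 * H) =
      of_nat p * (2 * (\<Sum>k=1..p-1. harmonic k / of_nat k)) - 4 * H"
    by simp
  also have "\<dots> = of_nat p * (H ^ 2 + Q) - 4 * H"
    by (simp only: sum_harmonic_over_index H_def Q_def)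
  finally have "of_nat p * (H ^ 2 + Q) - 4 * H \<in> p_ideal p 2" .
  from p_ideal_diff[OF p p_ideal_add[OF p pairing p_ideal_mult_left[OF p p_integral_of_nat[of p] HH]] this]
  have "of_nat 6 * H \<in> p_ideal p 2" by (simp add: algebra_simps)
  then show ?thesis unfolding H_def by (rule p_ideal_cancel_unit[OF p nd6])
qed

section \<open>Fibonacci and Lucas numbers\<close>

theorem corollary1p2:
  fixes p :: nat
  assumes "prime p" and "p > 3"
  shows "rat_cong (\<Sum>k=1..p-1. harmonic k * of_nat (lucas k) / of_nat k) 0 p
    \<and> rat_cong (\<Sum>k=1..p-1. of_nat (fib k) * harmonic k / of_nat k)
        (2 / of_nat p * (\<Sum>k=1..p-1. of_nat (fib k) / of_nat k)) p"
proof
  note p = assms(1)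
  let ?SL = "\<Sum>k=1..p-1. harmonic k * of_nat (lucas k) / of_nat k"
  let ?SF = "\<Sum>k=1..p-1. of_nat (fib k) * harmonic k / of_nat k"
  let ?T = "\<Sum>k=1..p-1. of_nat (fib k) / of_nat k :: rat"
  have "of_nat p * ?SL - (\<Sum>k=1..p-1. 2 / of_nat k) \<in> p_ideal p 2"
    using harmonic_sum_cong[OF p, of "\<lambda>k. of_nat (lucas k)"] p_integral_of_nat
    by (simp add: binomial_transform_lucas)
  also have "(\<Sum>k=1..p-1. 2 / of_nat k) = of_nat 2 * harmonic (p - 1)"
    by (simp add: harmonic_altdef sum_distrib_left)
  finally have "of_nat p * ?SL - of_nat 2 * harmonic (p - 1) \<in> p_ideal p 2" .
  from p_ideal_add[OF p this
      p_ideal_mult_left[OF p p_integral_of_nat[of 2] wolstenholme_harmonic[OF assms]]]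
  have "of_nat p * ?SL \<in> p_ideal p (Suc 1)" by (simp add: numeral_2_eq_2)
  then show "rat_cong ?SL 0 p"
    unfolding rat_cong_iff_p_ideal by (simp only: diff_0_right p_ideal_cancel_p[OF p])
  have p0: "(of_nat p :: rat) \<noteq> 0" using p by auto
  have "of_nat p * (\<Sum>k=1..p-1. harmonic k * of_nat (fib k) / of_nat k)
      - (\<Sum>k=1..p-1. (of_nat (fib k) + of_nat (fib k)) / of_nat k) \<in> p_ideal p 2"
    using harmonic_sum_cong[OF p, of "\<lambda>k. of_nat (fib k)"] p_integral_of_nat
    by (simp add: binomial_transform_fib)
  also have "(\<Sum>k=1..p-1. harmonic k * of_nat (fib k) / of_nat k) = ?SF"
    by (simp add: mult.commute)
  also have "(\<Sum>k=1..p-1. (of_nat (fib k) + of_nat (fib k)) / of_nat k) = 2 * ?T"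
    by (simp add: sum_distrib_left)
  also have "of_nat p * ?SF - 2 * ?T = of_nat p * (?SF - 2 / of_nat p * ?T)"
    using p0 by (simp add: right_diff_distrib)
  finally have "of_nat p * (?SF - 2 / of_nat p * ?T) \<in> p_ideal p (Suc 1)"
    by (simp add: numeral_2_eq_2)
  then show "rat_cong ?SF (2 / of_nat p * ?T) p"
    unfolding rat_cong_iff_p_ideal by (rule p_ideal_cancel_p[OF p])
qed

end
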